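(* Let $n\ge2$ and let $V=\mathbb{C}^{\{1,\dots,n\}}$ be the defining permutation representation of $S_n$. Consider the coset identification problem for the subgroup $A_n\le S_n$, i.e. determining the sign of a hidden uniformly random permutation $a\in S_n$ given oracle access to its permutation matrix. Then there is a $t$-query quantum algorithm succeeding with probability $1$ for $t=\lfloor n/2\rfloor$, while for every $t<\lfloor n/2\rfloor$ the optimal $t$-query success probability is exactly $1/2$.
   Context: A $t$-query algorithm consists of $N\ge1$, unit vector $\psi\in V\otimes\mathbb{C}^N$, unitaries $U_1,\dots,U_t$ on $V\otimes\mathbb{C}^N$ and a two-outcome POVM $\{E_{+1},E_{-1}\}$; on hidden $a$ it produces $\psi_a=U_t(\pi(a)\otimes I)\cdots U_1(\pi(a)\otimes I)\psi$ where $\pi(a)$ is the permutation matrix of $a$; success probability is $\frac1{n!}\sum_{a\in S_n}\langle\psi_a|E_{\mathrm{sgn}(a)}|\psi_a\rangle$. *)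

theory Defs
  imports Complex_Main "HOL-Combinatorics.Permutations" "Jordan_Normal_Form.Matrix"
begin

text \<open>The space V \<otimes> C^N with V = C^n is modelled as C^(n*N); the basis vector
  e_i \<otimes> f_k (i < n, k < N) is the standard basis vector with index i*N + k.
  Symmetric group S_n acts on {0..<n}.\<close>

definition cinner :: "complex vec \<Rightarrow> complex vec \<Rightarrow> complex" where
  "cinner v w = (\<Sum>i<dim_vec v. cnj (v $ i) * w $ i)"

definition cadj :: "complex mat \<Rightarrow> complex mat" where
  "cadj A = mat (dim_col A) (dim_row A) (\<lambda>(i,j). cnj (A $$ (j,i)))"

definition unitary_mat :: "nat \<Rightarrow> complex mat \<Rightarrow> bool" where
  "unitary_mat d U \<longleftrightarrow> U \<in> carrier_mat d d \<and> U * cadj U = 1\<^sub>m d \<and> cadj U * U = 1\<^sub>m d"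

definition psd_mat :: "nat \<Rightarrow> complex mat \<Rightarrow> bool" where
  "psd_mat d E \<longleftrightarrow> E \<in> carrier_mat d d \<and>
     (\<forall>v \<in> carrier_vec d. Complex.Im (cinner v (E *\<^sub>v v)) = 0 \<and> Complex.Re (cinner v (E *\<^sub>v v)) \<ge> 0)"

definition povm2 :: "nat \<Rightarrow> complex mat \<Rightarrow> complex mat \<Rightarrow> bool" where
  "povm2 d Ep Em \<longleftrightarrow> psd_mat d Ep \<and> psd_mat d Em \<and> Ep + Em = 1\<^sub>m d"

text \<open>pi(a) \<otimes> I_N, where pi(a) e_j = e_{a j}.\<close>
definition perm_tensor :: "nat \<Rightarrow> nat \<Rightarrow> (nat \<Rightarrow> nat) \<Rightarrow> complex mat" where
  "perm_tensor n N a = mat (n*N) (n*N)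
     (\<lambda>(r,c). if r div N = a (c div N) \<and> r mod N = c mod N then 1 else 0)"

definition query_alg :: "nat \<Rightarrow> nat \<Rightarrow> nat \<Rightarrow> complex vec \<Rightarrow> complex mat list
    \<Rightarrow> complex mat \<Rightarrow> complex mat \<Rightarrow> bool" where
  "query_alg n t N psi Us Ep Em \<longleftrightarrow> N \<ge> 1 \<and> psi \<in> carrier_vec (n*N) \<and> cinner psi psi = 1 \<and>
     length Us = t \<and> (\<forall>U \<in> set Us. unitary_mat (n*N) U) \<and> povm2 (n*N) Ep Em"

definition final_state :: "nat \<Rightarrow> nat \<Rightarrow> complex vec \<Rightarrow> complex mat list \<Rightarrow> (nat \<Rightarrow> nat) \<Rightarrow> complex vec" where
  "final_state n N psi Us a = foldl (\<lambda>v U. U *\<^sub>v (perm_tensor n N a *\<^sub>v v)) psi Us"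

definition success_prob :: "nat \<Rightarrow> nat \<Rightarrow> complex vec \<Rightarrow> complex mat list
    \<Rightarrow> complex mat \<Rightarrow> complex mat \<Rightarrow> real" where
  "success_prob n N psi Us Ep Em =
     (1 / fact n) * (\<Sum>a \<in> {p. p permutes {..<n}}.
        Complex.Re (cinner (final_state n N psi Us a)
                   ((if sign a = 1 then Ep else Em) *\<^sub>v final_state n N psi Us a)))"

definition opt_success :: "nat \<Rightarrow> nat \<Rightarrow> real" where
  "opt_success n t = Sup {success_prob n N psi Us Ep Em | N psi Us Ep Em.
       query_alg n t N psi Us Ep Em}"

end

theory Submission
  imports Defs "Jordan_Normal_Form.Determinant"
begin

text \<open>
  Lower bound: the amplitudes after \<open>t\<close> queries are sums of functions depending on at most \<open>t\<close> values
  of \<open>a\<close>, so acceptance probabilities are sums of functions depending on at most \<open>2 t \<le> n - 2\<close> values.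
  Composing \<open>a\<close> with a transposition of two untouched points flips the sign and fixes such a function,
  so its average over even and over odd permutations agrees, and every algorithm succeeds with
  probability exactly \<open>1 / 2\<close>.

  Upper bound: with \<open>m = n div 2\<close>, the algorithm applies \<open>a\<close> to each factor of the Slater determinant
  \<open>w 0 \<and> \<dots> \<and> w (m - 1)\<close> of Fourier vectors spanning an isotropic subspace of \<open>V\<close>. The overlap of the
  states for \<open>a\<close> and \<open>b\<close> is the determinant of the Gram matrix between these vectors and their images
  under \<open>inv b \<circ> a\<close>, and it vanishes whenever \<open>sign a \<noteq> sign b\<close>. Projecting onto the span of the states
  of the even permutations therefore identifies the sign.
\<close>

section \<open>Sums of juntas and their signed sums over permutations\<close>

text \<open>On permutations of a finite set these are the polynomials of degree at most
  \<open>k\<close> in the indicators of \<open>a j = i\<close>. Closure under sums is a rule, so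
  linear claims reduce to single juntas.\<close>

inductive junta_sum :: "nat \<Rightarrow> ((nat \<Rightarrow> nat) \<Rightarrow> complex) \<Rightarrow> bool" for k where
  junta: "finite J \<Longrightarrow> card J \<le> k \<Longrightarrow> (\<And>a b. (\<And>j. j \<in> J \<Longrightarrow> a j = b j) \<Longrightarrow> f a = f b)
    \<Longrightarrow> junta_sum k f"
| add: "junta_sum k f \<Longrightarrow> junta_sum k g \<Longrightarrow> junta_sum k (\<lambda>a. f a + g a)"

lemma junta_sum_const: "junta_sum k (\<lambda>_. c)"
  by (rule junta_sum.junta[of "{}"]) auto

lemma junta_sum_sum:
  "finite I \<Longrightarrow> (\<And>i. i \<in> I \<Longrightarrow> junta_sum k (f i)) \<Longrightarrow> junta_sum k (\<lambda>a. \<Sum>i\<in>I. f i a)"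
  by (induction I rule: finite_induct) (auto intro: junta_sum_const junta_sum.add)

lemma junta_sum_cnj: "junta_sum k f \<Longrightarrow> junta_sum k (\<lambda>a. cnj (f a))"
proof (induction rule: junta_sum.induct)
  case (junta J f)
  show ?case
    by (rule junta_sum.junta[OF junta(1,2)]) (use junta(3) in metis)
next
  case (add f g)
  then show ?case by (auto intro: junta_sum.add)
qed

text \<open>Distributivity reduces to two juntas, whose product is a junta on the union of the
  supports; hence degrees add.\<close>

lemma junta_sum_mult:
  assumes "junta_sum k f" "junta_sum l g"
  shows "junta_sum (k + l) (\<lambda>a. f a * g a)"
  using assms(1)
proof (induction rule: junta_sum.induct)
  case (junta J f)
  show ?case using assms(2)
  proof (induction rule: junta_sum.induct)
    case (junta K g)
    note f = \<open>\<And>a b. (\<And>j. j \<in> J \<Longrightarrow> a j = b j) \<Longrightarrow> f a = f b\<close>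
    show ?case
    proof (rule junta_sum.junta)
      show "finite (J \<union> K)" using junta(1) \<open>finite J\<close> by simp
      show "card (J \<union> K) \<le> k + l"
        using card_Un_le[of J K] junta(2) \<open>card J \<le> k\<close> by linarith
      show "f a * g a = f b * g b" if "\<And>j. j \<in> J \<union> K \<Longrightarrow> a j = b j" for a b
        using f[of a b] junta(3)[of a b] that by auto
    qed
  next
    case (add g h)
    then show ?case by (auto simp: distrib_left intro: junta_sum.add)
  qed
next
  case (add f h)
  then show ?case by (auto simp: distrib_right intro: junta_sum.add)
qed

lemma signed_sum_junta_eq_0:
  assumes "junta_sum k f" "k + 2 \<le> n"
  shows "(\<Sum>a | a permutes {..<n}. of_int (sign a) * f a) = 0"
  using assms(1)
proof (induction rule: junta_sum.induct)
  case (junta J f)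
  have "\<not> card ({..<n} - J) \<le> 1"
    using diff_card_le_card_Diff[OF junta(1), of "{..<n}"] junta(2) assms(2) by simp
  then obtain x y where xy: "x \<in> {..<n} - J" "y \<in> {..<n} - J" "x \<noteq> y"
    using card_le_Suc0_iff_eq[of "{..<n} - J"] by auto
  let ?\<tau> = "transpose x y"
  have \<tau>: "?\<tau> permutes {..<n}"
    using xy by (intro permutes_swap_id) auto
  let ?S = "\<Sum>a | a permutes {..<n}. of_int (sign a) * f a"
  \<comment> \<open>Composing on the right moves only arguments outside \<open>J\<close>; composing
    on the left could change the values of \<open>a\<close> on \<open>J\<close>.\<close>
  have "?S = (\<Sum>a | a permutes {..<n}. of_int (sign (a \<circ> ?\<tau>)) * f (a \<circ> ?\<tau>))"
    by (rule sum_permutations_compose_right[OF \<tau>])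
  also have "\<dots> = (\<Sum>a | a permutes {..<n}. - (of_int (sign a) * f a))"
  proof (rule sum.cong[OF refl])
    fix a assume a: "a \<in> {a. a permutes {..<n}}"
    then have "permutation a" "permutation ?\<tau>"
      using \<tau> by (auto simp: permutation_permutes)
    then have "sign (a \<circ> ?\<tau>) = - sign a"
      using xy by (simp add: sign_compose sign_swap_id)
    moreover have "f (a \<circ> ?\<tau>) = f a"
      using xy by (intro junta(3)) (auto simp: transpose_def)
    ultimately show "of_int (sign (a \<circ> ?\<tau>)) * f (a \<circ> ?\<tau>) = - (of_int (sign a) * f a)"
      by simp
  qed
  also have "\<dots> = - ?S"
    by (simp add: sum_negf)
  finally show ?case
    by simp
next
  case (add f g)
  then show ?case by (simp add: distrib_left sum.distrib)
qed

section \<open>Amplitudes and acceptance probabilities as sums of juntas\<close>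

lemma mult_mat_vec_index_sum:
  "A \<in> carrier_mat d d \<Longrightarrow> v \<in> carrier_vec d \<Longrightarrow> i < d \<Longrightarrow>
    (A *\<^sub>v v) $ i = (\<Sum>j<d. A $$ (i, j) * v $ j)"
  by (auto simp: scalar_prod_def atLeast0LessThan intro!: sum.cong)

lemma perm_tensor_carrier [simp]: "perm_tensor n N a \<in> carrier_mat (n * N) (n * N)"
  by (simp add: perm_tensor_def)

lemma final_state_carrier:
  assumes "psi \<in> carrier_vec (n * N)" "\<forall>U \<in> set Us. unitary_mat (n * N) U"
  shows "final_state n N psi Us a \<in> carrier_vec (n * N)"
  using assms unfolding final_state_def
proof (induction Us arbitrary: psi)
  case (Cons U Us)
  then have "U *\<^sub>v (perm_tensor n N a *\<^sub>v psi) \<in> carrier_vec (n * N)"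
    by (auto simp: unitary_mat_def intro!: mult_mat_vec_carrier)
  then show ?case using Cons by simp
qed simp

text \<open>One more query yields sums of products of an entry of \<open>U\<close>, an oracle entry
  and an earlier amplitude. The oracle entry in column \<open>j\<close> reads only
  \<open>a (j div N)\<close>, so each query raises the degree by one.\<close>

lemma final_state_junta:
  assumes "psi \<in> carrier_vec (n * N)" "\<forall>U \<in> set Us. unitary_mat (n * N) U" "r < n * N"
  shows "junta_sum (length Us) (\<lambda>a. final_state n N psi Us a $ r)"
  using assms(2,3)
proof (induction Us arbitrary: r rule: rev_induct)
  case Nil
  then show ?case by (simp add: final_state_def junta_sum_const)
next
  case (snoc U Us)
  let ?d = "n * N" and ?v = "\<lambda>a. final_state n N psi Us a"
  have U: "U \<in> carrier_mat ?d ?d" using snoc by (auto simp: unitary_mat_def)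
  have v: "?v a \<in> carrier_vec ?d" for a
    using snoc assms(1) by (intro final_state_carrier) auto
  have ind: "junta_sum 1 (\<lambda>a. perm_tensor n N a $$ (i, j))" if "i < ?d" "j < ?d" for i j
    by (rule junta_sum.junta[of "{j div N}"]) (use that in \<open>auto simp: perm_tensor_def\<close>)
  have "final_state n N psi (Us @ [U]) a $ r =
      (\<Sum>i<?d. U $$ (r, i) * (\<Sum>j<?d. perm_tensor n N a $$ (i, j) * ?v a $ j))" for a
  proof -
    have "final_state n N psi (Us @ [U]) a $ r = (U *\<^sub>v (perm_tensor n N a *\<^sub>v ?v a)) $ r"
      by (simp add: final_state_def)
    also have "\<dots> = (\<Sum>i<?d. U $$ (r, i) * (perm_tensor n N a *\<^sub>v ?v a) $ i)"
      using snoc.prems(2) by (intro mult_mat_vec_index_sum[OF U] mult_mat_vec_carrier[OF perm_tensor_carrier v])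
    finally show ?thesis
      by (simp add: mult_mat_vec_index_sum[OF perm_tensor_carrier v])
  qed
  moreover have "junta_sum (0 + (1 + length Us)) (\<lambda>a. \<Sum>i<?d. U $$ (r, i) *
      (\<Sum>j<?d. perm_tensor n N a $$ (i, j) * ?v a $ j))"
    using snoc by (intro junta_sum_sum junta_sum_mult junta_sum_const ind) auto
  ultimately show ?case by simp
qed

text \<open>Each term contains one conjugated and one plain amplitude, which doubles the
  degree.\<close>

lemma quadratic_form_junta:
  assumes "psi \<in> carrier_vec (n * N)" "\<forall>U \<in> set Us. unitary_mat (n * N) U"
    and E: "E \<in> carrier_mat (n * N) (n * N)"
  shows "junta_sum (2 * length Us)
    (\<lambda>a. cinner (final_state n N psi Us a) (E *\<^sub>v final_state n N psi Us a))"
proof -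
  let ?d = "n * N" and ?v = "\<lambda>a. final_state n N psi Us a"
  have v: "?v a \<in> carrier_vec ?d" for a
    using assms by (intro final_state_carrier) auto
  have "cinner (?v a) (E *\<^sub>v ?v a) = (\<Sum>i<?d. cnj (?v a $ i) * (\<Sum>j<?d. E $$ (i, j) * ?v a $ j))" for a
    using v[of a] by (simp add: cinner_def mult_mat_vec_index_sum[OF E v])
  moreover have "junta_sum (length Us + (0 + length Us))
      (\<lambda>a. \<Sum>i<?d. cnj (?v a $ i) * (\<Sum>j<?d. E $$ (i, j) * ?v a $ j))"
    using assms by (intro junta_sum_sum junta_sum_mult junta_sum_const junta_sum_cnj final_state_junta) auto
  ultimately show ?thesis by (simp add: mult_2)
qed

section \<open>Inner products, unitarity and conservation of norm\<close>

lemma cinner_eq_sum: "v \<in> carrier_vec d \<Longrightarrow> cinner v w = (\<Sum>i<d. cnj (v $ i) * w $ i)"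
  by (simp add: cinner_def)

lemma cadj_carrier: "A \<in> carrier_mat m n \<Longrightarrow> cadj A \<in> carrier_mat n m"
  by (simp add: cadj_def)

lemma cinner_cadj:
  assumes "A \<in> carrier_mat d d" "v \<in> carrier_vec d" "w \<in> carrier_vec d"
  shows "cinner (A *\<^sub>v v) w = cinner v (cadj A *\<^sub>v w)"
proof -
  have Av: "A *\<^sub>v v \<in> carrier_vec d" using assms by auto
  have "cinner (A *\<^sub>v v) w = (\<Sum>i<d. \<Sum>j<d. cnj (A $$ (i, j)) * cnj (v $ j) * w $ i)"
    by (simp add: cinner_eq_sum[OF Av] mult_mat_vec_index_sum[OF assms(1,2)] sum_distrib_right
        del: index_mult_mat_vec)
  also have "\<dots> = (\<Sum>j<d. \<Sum>i<d. cnj (A $$ (i, j)) * cnj (v $ j) * w $ i)"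
    by (rule sum.swap)
  also have "\<dots> = (\<Sum>j<d. cnj (v $ j) * (\<Sum>i<d. cadj A $$ (j, i) * w $ i))"
    using assms by (simp add: cadj_def sum_distrib_left mult_ac)
  also have "\<dots> = cinner v (cadj A *\<^sub>v w)"
    using assms by (simp add: cinner_eq_sum mult_mat_vec_index_sum[OF cadj_carrier] del: index_mult_mat_vec)
  finally show ?thesis .
qed

lemma unitary_mat_cinner:
  assumes "unitary_mat d U" "v \<in> carrier_vec d" "w \<in> carrier_vec d"
  shows "cinner (U *\<^sub>v v) (U *\<^sub>v w) = cinner v w"
proof -
  have U: "U \<in> carrier_mat d d" "cadj U * U = 1\<^sub>m d" using assms by (auto simp: unitary_mat_def)
  have "cinner (U *\<^sub>v v) (U *\<^sub>v w) = cinner v (cadj U *\<^sub>v (U *\<^sub>v w))"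
    using U assms by (intro cinner_cadj) auto
  also have "cadj U *\<^sub>v (U *\<^sub>v w) = w"
    using assms U by (simp flip: assoc_mult_mat_vec[OF cadj_carrier[OF U(1)] U(1) assms(3)])
  finally show ?thesis .
qed

text \<open>Acts on a vector by substituting \<open>p\<close> into the index. Oracle and rotation
  both have this form, so a run of the exact algorithm only composes index maps.\<close>

definition row_map_mat :: "nat \<Rightarrow> (nat \<Rightarrow> nat) \<Rightarrow> complex mat" where
  "row_map_mat d p = mat d d (\<lambda>(r, c). if c = p r then 1 else 0)"

lemma row_map_mat_carrier [simp]: "row_map_mat d p \<in> carrier_mat d d"
  by (simp add: row_map_mat_def)

lemma row_map_mat_mult_vec:
  assumes "v \<in> carrier_vec d" "r < d" "p r < d"
  shows "(row_map_mat d p *\<^sub>v v) $ r = v $ p r"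
proof -
  have "(row_map_mat d p *\<^sub>v v) $ r = (\<Sum>j<d. if j = p r then v $ j else 0)"
    unfolding mult_mat_vec_index_sum[OF row_map_mat_carrier assms(1,2)]
    by (rule sum.cong) (use assms in \<open>auto simp: row_map_mat_def\<close>)
  then show ?thesis using assms by simp
qed

lemma unitary_row_map_mat:
  assumes "bij_betw p {..<d} {..<d}"
  shows "unitary_mat d (row_map_mat d p)"
proof -
  let ?P = "row_map_mat d p"
  have p: "p r < d" if "r < d" for r
    using assms that by (auto simp: bij_betw_def)
  have inj: "p i = p j \<longleftrightarrow> i = j" if "i < d" "j < d" for i j
    using assms that by (auto simp: bij_betw_def inj_on_def)
  have "?P * cadj ?P = 1\<^sub>m d"
  proof (rule eq_matI)
    fix i j assume "i < dim_row (1\<^sub>m d :: complex mat)" "j < dim_col (1\<^sub>m d :: complex mat)"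
    then have ij: "i < d" "j < d" by auto
    have "(?P * cadj ?P) $$ (i, j) = (\<Sum>k\<in>{0..<d}. (if k = p i then 1 else 0) * cnj (if k = p j then 1 else 0))"
      using ij by (simp add: row_map_mat_def cadj_def scalar_prod_def)
    also have "\<dots> = (\<Sum>k\<in>{0..<d}. if k = p i then if k = p j then 1 else 0 else 0)"
      by (rule sum.cong) auto
    also have "\<dots> = (1\<^sub>m d :: complex mat) $$ (i, j)"
      using ij p inj by simp
    finally show "(?P * cadj ?P) $$ (i, j) = (1\<^sub>m d :: complex mat) $$ (i, j)" .
  qed (auto simp: row_map_mat_def cadj_def)
  moreover from this have "cadj ?P * ?P = 1\<^sub>m d"
    by (rule mat_mult_left_right_inverse[rotated 2]) (auto intro: cadj_carrier)
  ultimately show ?thesis by (simp add: unitary_mat_def)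
qed

lemma less_mult_iff_div_less: "0 < N \<Longrightarrow> r < n * N \<longleftrightarrow> r div N < (n :: nat)"
  by (simp add: div_less_iff_less_mult)

lemma mult_add_less: "i < n \<Longrightarrow> k < N \<Longrightarrow> i * N + k < n * (N :: nat)"
  by (simp add: less_mult_iff_div_less)

text \<open>Since the oracle sends basis vector \<open>j\<close> of \<open>V\<close> to
  \<open>a j\<close>, coordinates are pulled back along the inverse of \<open>a\<close>.\<close>

lemma perm_tensor_eq_row_map_mat:
  assumes "a permutes {..<n}"
  shows "perm_tensor n N a = row_map_mat (n * N) (\<lambda>r. Hilbert_Choice.inv a (r div N) * N + r mod N)"
proof (rule eq_matI)
  fix i j assume "i < dim_row (row_map_mat (n * N) (\<lambda>r. Hilbert_Choice.inv a (r div N) * N + r mod N))"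
    "j < dim_col (row_map_mat (n * N) (\<lambda>r. Hilbert_Choice.inv a (r div N) * N + r mod N))"
  then have ij: "i < n * N" "j < n * N" by (auto simp: row_map_mat_def)
  then have N: "N > 0" by (cases N) auto
  have "i div N = a (j div N) \<longleftrightarrow> Hilbert_Choice.inv a (i div N) = j div N"
    using permutes_inverses[OF assms] by metis
  moreover have "j = Hilbert_Choice.inv a (i div N) * N + i mod N \<longleftrightarrow> Hilbert_Choice.inv a (i div N) = j div N \<and> i mod N = j mod N"
    using N by (metis add.commute div_mult_mod_eq div_mult_self3 mod_div_trivial add_0 mod_mult_self3 mod_mod_trivial less_irrefl)
  ultimately show "perm_tensor n N a $$ (i, j) =
      row_map_mat (n * N) (\<lambda>r. Hilbert_Choice.inv a (r div N) * N + r mod N) $$ (i, j)"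
    using ij by (auto simp: perm_tensor_def row_map_mat_def)
qed (auto simp: perm_tensor_def row_map_mat_def)

lemma unitary_perm_tensor:
  assumes "a permutes {..<n}"
  shows "unitary_mat (n * N) (perm_tensor n N a)"
  unfolding perm_tensor_eq_row_map_mat[OF assms]
proof (rule unitary_row_map_mat, rule bij_betw_byWitness)
  have N: "N > 0" if "r \<in> {..<n * N}" for r
    using that by (cases N) auto
  have a: "i < n \<Longrightarrow> a i < n" "i < n \<Longrightarrow> Hilbert_Choice.inv a i < n" for i
    using permutes_in_image[OF assms] permutes_in_image[OF permutes_inv[OF assms]] by auto
  let ?f = "\<lambda>r. Hilbert_Choice.inv a (r div N) * N + r mod N" and ?g = "\<lambda>r. a (r div N) * N + r mod N"
  show "\<forall>r\<in>{..<n * N}. ?g (?f r) = r" "\<forall>r\<in>{..<n * N}. ?f (?g r) = r"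
    using N by (auto simp: permutes_inverses[OF assms])
  show "?f ` {..<n * N} \<subseteq> {..<n * N}" "?g ` {..<n * N} \<subseteq> {..<n * N}"
    using N by (auto intro!: mult_add_less a simp flip: less_mult_iff_div_less)
qed

lemma final_state_norm:
  assumes "psi \<in> carrier_vec (n * N)" "\<forall>U \<in> set Us. unitary_mat (n * N) U" "a permutes {..<n}"
  shows "cinner (final_state n N psi Us a) (final_state n N psi Us a) = cinner psi psi"
  using assms unfolding final_state_def
proof (induction Us arbitrary: psi)
  case (Cons U Us)
  let ?v = "perm_tensor n N a *\<^sub>v psi"
  have v: "?v \<in> carrier_vec (n * N)"
    using Cons.prems by (intro mult_mat_vec_carrier[OF perm_tensor_carrier])
  have U: "unitary_mat (n * N) U" using Cons.prems by simp
  then have "U *\<^sub>v ?v \<in> carrier_vec (n * N)"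
    using v by (auto simp: unitary_mat_def intro!: mult_mat_vec_carrier[OF _ v])
  then show ?case
    using Cons unitary_mat_cinner[OF U v v]
      unitary_mat_cinner[OF unitary_perm_tensor[OF assms(3)], of psi N psi] by simp
qed simp

lemma povm2_form_sum:
  assumes "povm2 d Ep Em" "v \<in> carrier_vec d"
  shows "cinner v (Ep *\<^sub>v v) + cinner v (Em *\<^sub>v v) = cinner v v"
proof -
  have E: "Ep \<in> carrier_mat d d" "Em \<in> carrier_mat d d" "Ep + Em = 1\<^sub>m d"
    using assms by (auto simp: povm2_def psd_mat_def)
  have "Ep *\<^sub>v v + Em *\<^sub>v v = v"
    using assms(2) E add_mult_distrib_mat_vec[OF E(1,2) assms(2)] by simp
  moreover have "cinner v (Ep *\<^sub>v v + Em *\<^sub>v v) = cinner v (Ep *\<^sub>v v) + cinner v (Em *\<^sub>v v)"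
    unfolding cinner_eq_sum[OF assms(2)] using E assms(2)
    by (simp add: sum.distrib distrib_left del: index_mult_mat_vec)
  ultimately show ?thesis by simp
qed

section \<open>Success probability below the threshold\<close>

lemma card_permutes_lessThan: "card {a. a permutes {..<n :: nat}} = fact n"
  by (subst card_permutations) auto

lemma success_prob_eq_half:
  assumes alg: "query_alg n t N psi Us Ep Em" and t: "2 * t + 2 \<le> n"
  shows "success_prob n N psi Us Ep Em = 1 / 2"
proof -
  have psi: "psi \<in> carrier_vec (n * N)" "cinner psi psi = 1"
    and Us: "length Us = t" "\<forall>U \<in> set Us. unitary_mat (n * N) U"
    and povm: "povm2 (n * N) Ep Em" "Ep \<in> carrier_mat (n * N) (n * N)" "Em \<in> carrier_mat (n * N) (n * N)"
    using alg by (auto simp: query_alg_def povm2_def psd_mat_def)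
  let ?v = "final_state n N psi Us"
  let ?P = "{p. p permutes {..<n}}"
  let ?q = "\<lambda>E a. cinner (?v a) (E *\<^sub>v ?v a)"
  have total: "?q Ep a + ?q Em a = 1" if "a \<in> ?P" for a
    using povm2_form_sum[OF povm(1) final_state_carrier[OF psi(1) Us(2)]]
      final_state_norm[OF psi(1) Us(2)] psi(2) that by simp
  have signed: "(\<Sum>a\<in>?P. of_int (sign a) * ?q E a) = 0" if "E \<in> carrier_mat (n * N) (n * N)" for E
    using quadratic_form_junta[OF psi(1) Us(2) that] t Us(1) by (intro signed_sum_junta_eq_0) auto
  \<comment> \<open>One expression linear in \<open>sign a\<close> covers both signs, because the
    two outcome probabilities add up to 1; its signed parts then sum to zero.\<close>
  have "(\<Sum>a\<in>?P. ?q (if sign a = 1 then Ep else Em) a) =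
      (\<Sum>a\<in>?P. (1 + of_int (sign a) * ?q Ep a - of_int (sign a) * ?q Em a) / 2)"
  proof (rule sum.cong[OF refl])
    fix a assume "a \<in> ?P"
    from total[OF this] have "?q Em a = 1 - ?q Ep a" by (simp add: algebra_simps)
    moreover have "sign a = 1 \<or> sign a = - 1" by (rule sign_cases) auto
    ultimately show "?q (if sign a = 1 then Ep else Em) a =
        (1 + of_int (sign a) * ?q Ep a - of_int (sign a) * ?q Em a) / 2"
      by (auto simp: field_simps)
  qed
  also have "\<dots> = of_nat (card ?P) / 2"
    using signed povm by (simp add: sum_divide_distrib[symmetric] sum.distrib sum_subtractf)
  finally have "(\<Sum>a\<in>?P. ?q (if sign a = 1 then Ep else Em) a) = of_real (fact n / 2)"
    by (simp add: card_permutes_lessThan)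
  then have "success_prob n N psi Us Ep Em = 1 / fact n * Complex.Re (of_real (fact n / 2))"
    unfolding success_prob_def Re_sum[symmetric] by (rule arg_cong)
  then show ?thesis by simp
qed

lemma unitary_one_mat: "unitary_mat d (1\<^sub>m d)"
proof -
  have "cadj (1\<^sub>m d) = 1\<^sub>m d" by (rule eq_matI) (auto simp: cadj_def)
  then show ?thesis by (simp add: unitary_mat_def)
qed

text \<open>Rules out a supremum over the empty set. The witness has \<open>N = 1\<close>, a basis
  state, identity unitaries and the measurement that always answers even.\<close>

lemma query_alg_exists:
  assumes "n \<ge> 1"
  shows "\<exists>N psi Us Ep Em. query_alg n t N psi Us Ep Em"
proof -
  have "cinner v (1\<^sub>m n *\<^sub>v v) = of_real (\<Sum>i<n. (cmod (v $ i))\<^sup>2)" if "v \<in> carrier_vec n" for v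
    using that by (simp add: cinner_eq_sum complex_norm_square mult.commute del: of_real_power)
  then have "psd_mat n (1\<^sub>m n)"
    by (auto simp: psd_mat_def intro!: sum_nonneg simp del: one_mult_mat_vec)
  moreover have "psd_mat n (0\<^sub>m n n)"
    by (auto simp: psd_mat_def cinner_def)
  moreover have "cinner (unit_vec n 0) (unit_vec n 0) = 1"
  proof -
    have "cinner (unit_vec n 0) (unit_vec n 0) = (\<Sum>i<n. if i = 0 then 1 else 0)"
      unfolding cinner_def by (rule sum.cong) auto
    then show ?thesis using assms by simp
  qed
  ultimately have "query_alg n t 1 (unit_vec n 0) (replicate t (1\<^sub>m n)) (1\<^sub>m n) (0\<^sub>m n n)"
    by (auto simp: query_alg_def povm2_def unitary_one_mat)
  then show ?thesis by blast
qed

lemma opt_success_eq_half: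
  assumes "2 * t + 2 \<le> n"
  shows "opt_success n t = 1 / 2"
proof -
  \<comment> \<open>All algorithms have the same value, so the set is a singleton and its supremum
    is immediate.\<close>
  have "{success_prob n N psi Us Ep Em | N psi Us Ep Em. query_alg n t N psi Us Ep Em} = {1 / 2}"
    using query_alg_exists[of n t] success_prob_eq_half[OF _ assms] assms by force
  then show ?thesis by (simp add: opt_success_def)
qed

section \<open>Base-\<open>n\<close> digits and Slater determinants\<close>

text \<open>An index below \<open>n ^ m\<close> encodes a basis vector of the \<open>m\<close>-fold
  tensor power of \<open>V\<close>, one digit per factor, with digit 0 least significant.\<close>

definition digit :: "nat \<Rightarrow> nat \<Rightarrow> nat \<Rightarrow> nat" where
  "digit n l r = r div n ^ l mod n"

lemma digit_add_top_low:
  assumes "0 < n" "l < m"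
  shows "digit n l (k + i * n ^ m) = digit n l k"
proof -
  have m: "n ^ m = n ^ l * (n * n ^ (m - Suc l))"
    using assms by (simp flip: power_Suc power_add)
  have "(k + i * n ^ m) div n ^ l = k div n ^ l + i * n ^ (m - Suc l) * n"
    using assms div_mult_self2[of "n ^ l" k "i * n ^ (m - Suc l) * n"] by (simp add: m mult_ac)
  then show ?thesis by (simp add: digit_def)
qed

lemma digit_add_top: "k < n ^ m \<Longrightarrow> i < n \<Longrightarrow> digit n m (k + i * n ^ m) = i"
  by (simp add: digit_def)

lemma digit_div: "digit n l (r div n) = digit n (Suc l) r"
  by (simp add: digit_def div_mult2_eq)

text \<open>For \<open>r\<close> below \<open>n ^ m\<close> the digits run through all
  \<open>m\<close>-tuples, so the left side is the expanded product; the induction splits off the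
  top digit.\<close>

lemma sum_prod_digits:
  fixes f :: "nat \<Rightarrow> nat \<Rightarrow> 'a :: comm_semiring_1"
  assumes "0 < n"
  shows "(\<Sum>r<n ^ m. \<Prod>l<m. f l (digit n l r)) = (\<Prod>l<m. \<Sum>i<n. f l i)"
proof (induction m)
  case (Suc m)
  have digits: "(\<Prod>l<Suc m. f l (digit n l (k + i * n ^ m))) =
      (\<Prod>l<m. f l (digit n l k)) * f m i" if "k < n ^ m" "i < n" for k i
    using that assms by (simp add: digit_add_top_low digit_add_top)
  have "(\<Sum>r<n ^ Suc m. \<Prod>l<Suc m. f l (digit n l r)) =
      (\<Sum>i<n. \<Sum>k<n ^ m. \<Prod>l<Suc m. f l (digit n l (k + i * n ^ m)))"
    using sum.shift_bounds_nat_ivl[of "\<lambda>r. \<Prod>l<Suc m. f l (digit n l r)" 0 "_ * n ^ m" "n ^ m"]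
    by (simp add: sum.nat_group[symmetric] atLeast0LessThan add.commute del: prod.lessThan_Suc)
  also have "\<dots> = (\<Sum>i<n. \<Sum>k<n ^ m. (\<Prod>l<m. f l (digit n l k)) * f m i)"
    by (intro sum.cong refl digits) auto
  also have "\<dots> = (\<Sum>k<n ^ m. \<Prod>l<m. f l (digit n l k)) * (\<Sum>i<n. f m i)"
    unfolding sum_product by (rule sum.swap)
  finally show ?case using Suc by simp
qed (use assms in simp)

text \<open>Coordinates, in the digit encoding, of the unnormalised wedge product of
  \<open>f 0, ..., f (m - 1)\<close>.\<close>

definition slater :: "nat \<Rightarrow> nat \<Rightarrow> (nat \<Rightarrow> nat \<Rightarrow> complex) \<Rightarrow> nat \<Rightarrow> complex" where
  "slater n m f r = det (mat m m (\<lambda>(l, k). f k (digit n l r)))"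

text \<open>Andreief's form of the Cauchy-Binet identity. Both determinants are expanded over
  permutations and the sum over \<open>r\<close> factors over digits. For fixed \<open>p\<close> the
  sum over \<open>q\<close> is the Gram determinant with rows permuted by \<open>p\<close>; the
  signs cancel, and each of the \<open>fact m\<close> permutations contributes
  \<open>det G\<close>.\<close>

lemma slater_inner:
  assumes "0 < n"
  shows "(\<Sum>r<n ^ m. cnj (slater n m f r) * slater n m g r) =
    fact m * det (mat m m (\<lambda>(k, l). \<Sum>i<n. cnj (f k i) * g l i))"
proof -
  let ?P = "{p. p permutes {0..<m}}"
  define G where "G = mat m m (\<lambda>(k, l). \<Sum>i<n. cnj (f k i) * g l i)"
  have G: "G \<in> carrier_mat m m" by (simp add: G_def)
  have less: "p l < m" if "p \<in> ?P" "l < m" for p l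
    using that permutes_in_image[of p "{0..<m}" l] by auto
  have exp: "slater n m h r = (\<Sum>p\<in>?P. of_int (sign p) * (\<Prod>l<m. h (p l) (digit n l r)))" for h r
    unfolding slater_def by (subst det_def') (auto intro!: sum.cong prod.cong simp: less atLeast0LessThan)
  have "(\<Sum>r<n ^ m. cnj (slater n m f r) * slater n m g r) =
      (\<Sum>r<n ^ m. \<Sum>p\<in>?P. \<Sum>q\<in>?P. of_int (sign p) * of_int (sign q) *
        (\<Prod>l<m. cnj (f (p l) (digit n l r)) * g (q l) (digit n l r)))"
    unfolding exp cnj_sum sum_product by (simp add: prod.distrib mult_ac)
  also have "\<dots> = (\<Sum>p\<in>?P. \<Sum>q\<in>?P. \<Sum>r<n ^ m. of_int (sign p) * of_int (sign q) *
        (\<Prod>l<m. cnj (f (p l) (digit n l r)) * g (q l) (digit n l r)))"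
    by (subst sum.swap, rule sum.cong[OF refl], rule sum.swap)
  also have "\<dots> = (\<Sum>p\<in>?P. \<Sum>q\<in>?P. of_int (sign p) * of_int (sign q) *
        (\<Prod>l<m. \<Sum>i<n. cnj (f (p l) i) * g (q l) i))"
    by (intro sum.cong refl)
      (simp add: sum_prod_digits[OF assms, where m = m, symmetric] sum_distrib_left)
  also have "\<dots> = (\<Sum>p\<in>?P. of_int (sign p) * det (mat m m (\<lambda>(k, l). G $$ (p k, l))))"
    by (subst det_def'[where n = m])
      (auto simp: sum_distrib_left mult.assoc G_def less atLeast0LessThan intro!: sum.cong prod.cong)
  also have "\<dots> = (\<Sum>p\<in>?P. det G)"
  proof (rule sum.cong[OF refl])
    fix p assume "p \<in> ?P"
    then have "det (mat m m (\<lambda>(k, l). G $$ (p k, l))) = of_int (sign p) * det G"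
      using det_permute_rows[OF G] by simp
    moreover have "sign p = 1 \<or> sign p = - 1" by (rule sign_cases) auto
    ultimately show "of_int (sign p) * det (mat m m (\<lambda>(k, l). G $$ (p k, l))) = det G"
      by auto
  qed
  also have "\<dots> = fact m * det G"
    by (subst sum_constant, subst card_permutations[of _ m]) auto
  finally show ?thesis by (simp add: G_def)
qed

section \<open>Fourier basis closed under conjugation\<close>

text \<open>
  Twice the frequency of the \<open>k\<close>-th Fourier vector. The first \<open>n div 2\<close> vectors, their complex
  conjugates and, for odd \<open>n\<close>, the all-ones vector must form one orthonormal basis; for even \<open>n\<close> this
  forces half-integer frequencies.
\<close>
definition query_freq :: "nat \<Rightarrow> nat \<Rightarrow> int" where
  "query_freq n k = (let m = n div 2; e = (if even n then 1 else 2) in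
     if k < m then 2 * int k + e
     else if k < 2 * m then - (2 * int (k - m) + e) else 0)"

text \<open>The factor is \<open>pi\<close> and not \<open>2 * pi\<close> because
  \<open>query_freq\<close> is already twice the frequency.\<close>

definition fourier :: "nat \<Rightarrow> nat \<Rightarrow> nat \<Rightarrow> complex" where
  "fourier n k j = cis (pi * real_of_int (query_freq n k) * real j / real n) / complex_of_real (sqrt (real n))"

text \<open>Below \<open>n\<close> the values of \<open>query_freq\<close> are distinct, have the
  parity opposite to \<open>n\<close> and lie between \<open>1 - n\<close> and \<open>n - 1\<close>.
  So half a difference is a nonzero integer too small to be a multiple of \<open>n\<close>, as
  orthogonality requires.\<close>

lemma query_freq_diff:
  assumes "k < n" "l < n" "k \<noteq> l"
  obtains d where "query_freq n l - query_freq n k = 2 * d" "d \<noteq> 0" "\<bar>d\<bar> < int n"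
proof
  let ?d = "(query_freq n l - query_freq n k) div 2"
  have "even (query_freq n l - query_freq n k)"
    using assms by (cases "even n") (auto simp: query_freq_def Let_def elim!: oddE evenE)
  then show *: "query_freq n l - query_freq n k = 2 * ?d" by simp
  have ne: "query_freq n l \<noteq> query_freq n k" and le: "\<bar>query_freq n l - query_freq n k\<bar> < 2 * int n"
    using assms by (cases "even n"; auto simp: query_freq_def Let_def elim!: oddE evenE split: if_splits)+
  show "?d \<noteq> 0" "\<bar>?d\<bar> < int n" using * ne le by linarith+
qed

lemma sum_roots_of_unity:
  assumes "d \<noteq> 0" "\<bar>d\<bar> < int n"
  shows "(\<Sum>j<n. cis (2 * pi * real_of_int d * real j / real n)) = 0"
proof -
  define z where "z = cis (2 * pi * real_of_int d / real n)"
  have n: "n > 0" using assms by auto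
  have pow: "cis (2 * pi * real_of_int d * real j / real n) = z ^ j" for j
    by (simp add: z_def DeMoivre mult_ac)
  have "z ^ n = 1"
    using n cis_multiple_2pi[of "real_of_int d"] by (simp add: z_def DeMoivre)
  moreover have "z \<noteq> 1"
  proof
    assume "z = 1"
    then have "cos (2 * pi * real_of_int d / real n) = 1"
      by (simp add: z_def complex_eq_iff)
    then obtain x :: int where "2 * pi * real_of_int d / real n = real_of_int x * 2 * pi"
      using cos_one_2pi_int by blast
    then have "real_of_int d = real_of_int (x * int n)"
      using n by (simp add: field_simps)
    then have d: "d = x * int n" by linarith
    then have "x \<noteq> 0" using assms by auto
    then have "int n \<le> \<bar>d\<bar>"
      using n by (simp add: d abs_mult)
    then show False using assms by simp
  qed
  ultimately show ?thesis
    unfolding pow by (simp add: geometric_sum)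
qed

lemma fourier_orthonormal:
  assumes "k < n" "l < n"
  shows "(\<Sum>j<n. cnj (fourier n k j) * fourier n l j) = (if k = l then 1 else 0)"
proof -
  let ?D = "query_freq n l - query_freq n k"
  have "cnj (fourier n k j) * fourier n l j = cis (pi * real_of_int ?D * real j / real n) / of_nat n" for j
  proof -
    have "cnj (fourier n k j) * fourier n l j =
      cis (pi * real_of_int ?D * real j / real n) / complex_of_real (sqrt (real n) * sqrt (real n))"
      unfolding fourier_def of_real_mult
      by (simp add: cis_cnj cis_mult algebra_simps diff_divide_distrib)
    then show ?thesis by simp
  qed
  then have eq: "(\<Sum>j<n. cnj (fourier n k j) * fourier n l j) =
      (\<Sum>j<n. cis (pi * real_of_int ?D * real j / real n)) / of_nat n"
    by (simp add: sum_divide_distrib)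
  show ?thesis
  proof (cases "k = l")
    case True
    then show ?thesis using assms unfolding eq by simp
  next
    case False
    then obtain d where d: "?D = 2 * d" "d \<noteq> 0" "\<bar>d\<bar> < int n"
      using query_freq_diff assms by metis
    show ?thesis
      using sum_roots_of_unity[OF d(2,3)] False unfolding eq d(1) by (simp add: mult_ac)
  qed
qed

lemma fourier_cnj:
  "k < n div 2 \<Longrightarrow> fourier n (n div 2 + k) j = cnj (fourier n k j)"
proof -
  assume "k < n div 2"
  then have "query_freq n (n div 2 + k) = - query_freq n k"
    by (simp add: query_freq_def Let_def)
  then show ?thesis by (simp add: fourier_def cis_cnj)
qed

lemma fourier_last:
  "2 * (n div 2) \<le> k \<Longrightarrow> fourier n k j = fourier n k i"
proof -
  assume "2 * (n div 2) \<le> k"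
  then have "query_freq n k = 0" by (simp add: query_freq_def Let_def)
  then show ?thesis by (simp add: fourier_def)
qed

section \<open>Gram determinant of an isotropic frame\<close>

text \<open>
  The span of \<open>w 0, \<dots>, w (m - 1)\<close> is isotropic, so the decomposable \<open>m\<close>-vector it defines is an
  eigenvector of the Hodge star, and odd permutations exchange the two eigenspaces. In matrices:
  with \<open>W\<close> the adjoint of the basis matrix and \<open>Y\<close> the basis matrix with its last columns permuted by
  \<open>\<sigma> = inv \<tau>\<close>, permuting the rows of \<open>Y\<close> by \<open>\<tau>\<close> gives \<open>X\<close>, while \<open>W * X\<close> and \<open>W * Y\<close> are block
  triangular with determinants \<open>det A\<close> and \<open>det A\<^sup>T\<close>. Hence \<open>det A = sign \<tau> * det A\<close>.
\<close>
lemma isotropic_gram_det_eq_0: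
  fixes w :: "nat \<Rightarrow> nat \<Rightarrow> complex"
  assumes orth: "\<And>k l. k < n \<Longrightarrow> l < n \<Longrightarrow> (\<Sum>i<n. cnj (w k i) * w l i) = (if k = l then 1 else 0)"
    and conj: "\<And>k i. k < m \<Longrightarrow> w (m + k) i = cnj (w k i)"
    and const: "\<And>k i j. 2 * m \<le> k \<Longrightarrow> k < n \<Longrightarrow> w k i = w k j"
    and m: "2 * m \<le> n"
    and \<tau>: "\<tau> permutes {..<n}" "sign \<tau> \<noteq> 1"
  shows "det (mat m m (\<lambda>(k, l). \<Sum>i<n. cnj (w k i) * w l (\<tau> i))) = 0"
proof -
  define \<sigma> where "\<sigma> = Hilbert_Choice.inv \<tau>"
  have \<sigma>: "\<sigma> permutes {..<n}" "\<sigma> (\<tau> i) = i" "\<tau> (\<sigma> i) = i" for i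
    using permutes_inv[OF \<tau>(1)] permutes_inverses[OF \<tau>(1)] by (auto simp: \<sigma>_def)
  have \<tau>_less: "i < n \<Longrightarrow> \<tau> i < n" for i
    using permutes_in_image[OF \<tau>(1)] by auto
  \<comment> \<open>Reindexing by \<open>\<tau>\<close> moves \<open>\<sigma>\<close> off one factor
    and puts \<open>\<tau>\<close> on the other.\<close>
  have shift: "(\<Sum>i<n. f i * g (\<sigma> i)) = (\<Sum>i<n. f (\<tau> i) * g i)" for f g :: "nat \<Rightarrow> complex"
    using sum.permute[OF \<tau>(1), of "\<lambda>i. f i * g (\<sigma> i)"] by (simp add: \<sigma>)
  define A where "A = mat m m (\<lambda>(k, l). \<Sum>i<n. cnj (w k i) * w l (\<tau> i))"
  define W where "W = mat n n (\<lambda>(k, i). cnj (w k i))"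
  define X where "X = mat n n (\<lambda>(i, l). if l < m then w l (\<tau> i) else w l i)"
  define Y where "Y = mat n n (\<lambda>(i, l). if l < m then w l i else w l (\<sigma> i))"
  define B where "B = mat m (n - m) (\<lambda>(k, l). \<Sum>i<n. cnj (w k i) * w (m + l) (\<sigma> i))"
  define C where "C = mat (n - m) m (\<lambda>(k, l). \<Sum>i<n. cnj (w (m + k) i) * w l (\<tau> i))"
  define D where "D = mat (n - m) (n - m) (\<lambda>(k, l). \<Sum>i<n. cnj (w (m + k) i) * w (m + l) (\<sigma> i))"
  have W: "W \<in> carrier_mat n n" and X: "X \<in> carrier_mat n n" and Y: "Y \<in> carrier_mat n n"
    and A: "A \<in> carrier_mat m m" and D: "D \<in> carrier_mat (n - m) (n - m)"
    by (simp_all add: W_def X_def Y_def A_def D_def)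
  have "X = mat n n (\<lambda>(i, l). Y $$ (\<tau> i, l))"
    by (rule eq_matI) (auto simp: X_def Y_def \<tau>_less \<sigma>)
  then have detX: "det X = of_int (sign \<tau>) * det Y"
    using det_permute_rows[OF Y, of \<tau>] \<tau>(1) by (simp add: atLeast0LessThan)
  have "W * X = four_block_mat A (0\<^sub>m m (n - m)) C (1\<^sub>m (n - m))"
    using m by (intro eq_matI)
      (auto simp: W_def X_def A_def C_def scalar_prod_def atLeast0LessThan orth)
  then have WX: "det W * det X = det A"
    using det_mult[OF W X] det_four_block_mat_upper_right_zero[OF A refl, of C "n - m" "1\<^sub>m (n - m)"]
    by (simp add: C_def)
  have "W * Y = four_block_mat (1\<^sub>m m) B (0\<^sub>m (n - m) m) D"
    using m by (intro eq_matI)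
      (auto simp: W_def Y_def B_def D_def scalar_prod_def atLeast0LessThan orth)
  then have WY: "det W * det Y = det D"
    using det_mult[OF W Y] det_four_block_mat_lower_left_zero[of "1\<^sub>m m" m B "n - m" "0\<^sub>m (n - m) m" D] D
    by (simp add: B_def)
  \<comment> \<open>Among the conjugate vectors, conjugation and \<open>shift\<close> give the
    entries of \<open>A\<close> with indices exchanged. A remaining constant vector is fixed by
    permutations and gives the identity block.\<close>
  have "D = four_block_mat (transpose_mat A) (0\<^sub>m m (n - 2 * m)) (0\<^sub>m (n - 2 * m) m) (1\<^sub>m (n - 2 * m))"
    (is "D = ?F")
  proof (rule eq_matI)
    fix k l assume "k < dim_row ?F" "l < dim_col ?F"
    then have kl: "k < n - m" "l < n - m"
      using m by (auto simp: A_def)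
    then have D_kl: "D $$ (k, l) = (\<Sum>i<n. cnj (w (m + k) i) * w (m + l) (\<sigma> i))"
      by (simp add: D_def)
    have F_kl: "?F $$ (k, l) = (if k < m \<and> l < m then \<Sum>i<n. cnj (w l i) * w k (\<tau> i) else if k = l then 1 else 0)"
      using kl m by (auto simp: A_def)
    consider "k < m" "l < m" | "m \<le> l" | "m \<le> k" by linarith
    then show "D $$ (k, l) = ?F $$ (k, l)"
    proof cases
      case 1
      then show ?thesis
        unfolding D_kl F_kl using shift[of "w k" "\<lambda>i. cnj (w l i)"] by (simp add: conj mult.commute)
    next
      case 2
      then have "w (m + l) (\<sigma> i) = w (m + l) i" for i
        using kl by (intro const) auto
      then show ?thesis unfolding D_kl F_kl using kl 2 by (simp add: orth)
    next
      case 3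
      then have "w (m + k) (\<tau> i) = w (m + k) i" for i
        using kl by (intro const) auto
      then show ?thesis
        unfolding D_kl F_kl shift[of "\<lambda>i. cnj (w (m + k) i)" "w (m + l)"] using kl 3 by (simp add: orth)
    qed
  qed (use m in \<open>auto simp: A_def D_def\<close>)
  then have "det D = det A"
    using det_four_block_mat_upper_right_zero[of "transpose_mat A" m "0\<^sub>m m (n - 2 * m)" "n - 2 * m" "0\<^sub>m (n - 2 * m) m" "1\<^sub>m (n - 2 * m)"]
      A det_transpose[OF A] by simp
  then have "det A = of_int (sign \<tau>) * det A"
    using WX WY detX by (metis mult.left_commute)
  moreover have "sign \<tau> = - 1"
    using \<tau>(2) by (auto intro: sign_cases[of \<tau>])
  ultimately show ?thesis by (simp add: A_def)
qed

section \<open>Orthogonal projections as measurements\<close>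

lemma cinner_add_right:
  "v \<in> carrier_vec d \<Longrightarrow> x \<in> carrier_vec d \<Longrightarrow> y \<in> carrier_vec d \<Longrightarrow>
    cinner v (x + y) = cinner v x + cinner v y"
  by (simp add: cinner_def sum.distrib distrib_left)

lemma cinner_diff_right:
  "v \<in> carrier_vec d \<Longrightarrow> x \<in> carrier_vec d \<Longrightarrow> y \<in> carrier_vec d \<Longrightarrow>
    cinner v (x - y) = cinner v x - cinner v y"
  by (simp add: cinner_def sum_subtractf right_diff_distrib)

lemma cinner_smult_right:
  "v \<in> carrier_vec d \<Longrightarrow> x \<in> carrier_vec d \<Longrightarrow> cinner v (c \<cdot>\<^sub>v x) = c * cinner v x"
  by (simp add: cinner_def sum_distrib_left mult_ac)

lemma cinner_commute:
  "v \<in> carrier_vec d \<Longrightarrow> w \<in> carrier_vec d \<Longrightarrow> cinner v w = cnj (cinner w v)"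
  by (simp add: cinner_def mult.commute)

lemma cinner_self: "cinner v v = of_real (\<Sum>i<dim_vec v. (cmod (v $ i))\<^sup>2)"
  by (simp add: cinner_def complex_norm_square mult.commute del: of_real_power)

lemma cinner_self_eq_0: "v \<in> carrier_vec d \<Longrightarrow> cinner v v = 0 \<Longrightarrow> v = 0\<^sub>v d"
  unfolding cinner_self of_real_eq_0_iff by (subst (asm) sum_nonneg_eq_0_iff) auto

definition orth_projection :: "nat \<Rightarrow> complex mat \<Rightarrow> bool" where
  "orth_projection d P \<longleftrightarrow> P \<in> carrier_mat d d \<and>
    (\<forall>x \<in> carrier_vec d. P *\<^sub>v (P *\<^sub>v x) = P *\<^sub>v x) \<and>
    (\<forall>x \<in> carrier_vec d. \<forall>y \<in> carrier_vec d. cinner (P *\<^sub>v x) y = cinner x (P *\<^sub>v y))"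

text \<open>Both quadratic forms are squared norms, of \<open>P *\<^sub>v x\<close> and of
  \<open>x - P *\<^sub>v x\<close>, hence real and nonnegative.\<close>

lemma orth_projection_povm2:
  assumes "orth_projection d P"
  shows "povm2 d P (1\<^sub>m d - P)"
proof -
  have P: "P \<in> carrier_mat d d" "\<And>x. x \<in> carrier_vec d \<Longrightarrow> P *\<^sub>v (P *\<^sub>v x) = P *\<^sub>v x"
    "\<And>x y. x \<in> carrier_vec d \<Longrightarrow> y \<in> carrier_vec d \<Longrightarrow> cinner (P *\<^sub>v x) y = cinner x (P *\<^sub>v y)"
    using assms by (auto simp: orth_projection_def)
  have psd: "Complex.Im (cinner y y) = 0 \<and> Complex.Re (cinner y y) \<ge> 0" for y
    by (simp add: cinner_self sum_nonneg)
  have "cinner x (P *\<^sub>v x) = cinner (P *\<^sub>v x) (P *\<^sub>v x)" if x: "x \<in> carrier_vec d" for x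
  proof -
    have "P *\<^sub>v x \<in> carrier_vec d" using P(1) x by (rule mult_mat_vec_carrier)
    from P(3)[OF x this] show ?thesis using P(2)[OF x] by simp
  qed
  moreover have "cinner x ((1\<^sub>m d - P) *\<^sub>v x) = cinner (x - P *\<^sub>v x) (x - P *\<^sub>v x)"
    if x: "x \<in> carrier_vec d" for x
  proof -
    have Px: "P *\<^sub>v x \<in> carrier_vec d" and y: "x - P *\<^sub>v x \<in> carrier_vec d"
      using P(1) x by auto
    have "P *\<^sub>v (x - P *\<^sub>v x) = 0\<^sub>v d"
      using mult_minus_distrib_mat_vec[OF P(1) x Px] P(2)[OF x] Px by simp
    then have "cinner (x - P *\<^sub>v x) (P *\<^sub>v x) = 0"
      using P(3)[OF y x] x by (simp add: cinner_def)
    moreover have "cinner (x - P *\<^sub>v x) (x - P *\<^sub>v x) = cinner (x - P *\<^sub>v x) x - cinner (x - P *\<^sub>v x) (P *\<^sub>v x)"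
      by (rule cinner_diff_right[OF y x Px])
    moreover have "cinner (x - P *\<^sub>v x) x = cnj (cinner x (x - P *\<^sub>v x))"
      by (rule cinner_commute[OF y x])
    moreover have "cinner (x - P *\<^sub>v x) (x - P *\<^sub>v x) = cnj (cinner (x - P *\<^sub>v x) (x - P *\<^sub>v x))"
      by (rule cinner_commute[OF y y])
    moreover have "(1\<^sub>m d - P) *\<^sub>v x = x - P *\<^sub>v x"
      using minus_mult_distrib_mat_vec[OF one_carrier_mat P(1) x] x by simp
    ultimately show ?thesis by simp
  qed
  moreover have "P + (1\<^sub>m d - P) = 1\<^sub>m d"
    using P(1) by (intro eq_matI) auto
  ultimately show ?thesis
    using P(1) psd by (auto simp: povm2_def psd_mat_def)
qed

text \<open>Gram-Schmidt in projection form: each new vector \<open>v\<close> adds the rank-one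
  projection onto its residual \<open>u\<close>, the part of \<open>v\<close> orthogonal to the
  range of \<open>P\<close>, unless this residual is zero.\<close>

lemma exists_orth_projection:
  assumes "finite S" "S \<subseteq> carrier_vec d"
  shows "\<exists>P. orth_projection d P \<and> (\<forall>s\<in>S. P *\<^sub>v s = s) \<and>
    (\<forall>x \<in> carrier_vec d. (\<forall>s\<in>S. cinner s x = 0) \<longrightarrow> P *\<^sub>v x = 0\<^sub>v d)"
  using assms
proof (induction rule: finite_induct)
  case empty
  have "0\<^sub>m d d *\<^sub>v x = (0\<^sub>v d :: complex vec)" if "x \<in> carrier_vec d" for x
    using that by (intro eq_vecI) (auto simp: scalar_prod_def)
  then show ?case
    by (intro exI[of _ "0\<^sub>m d d"]) (simp add: orth_projection_def cinner_def)
next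
  case (insert v S)
  then have v: "v \<in> carrier_vec d" and S: "S \<subseteq> carrier_vec d" by auto
  from insert.IH[OF S] obtain P where P: "P \<in> carrier_mat d d"
    and idem: "\<And>x. x \<in> carrier_vec d \<Longrightarrow> P *\<^sub>v (P *\<^sub>v x) = P *\<^sub>v x"
    and symm: "\<And>x y. x \<in> carrier_vec d \<Longrightarrow> y \<in> carrier_vec d \<Longrightarrow> cinner (P *\<^sub>v x) y = cinner x (P *\<^sub>v y)"
    and fix_S: "\<And>s. s \<in> S \<Longrightarrow> P *\<^sub>v s = s"
    and perp: "\<And>x. x \<in> carrier_vec d \<Longrightarrow> (\<And>s. s \<in> S \<Longrightarrow> cinner s x = 0) \<Longrightarrow> P *\<^sub>v x = 0\<^sub>v d"
    unfolding orth_projection_def by blast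
  have Pc: "P *\<^sub>v x \<in> carrier_vec d" if "x \<in> carrier_vec d" for x
    using P that by (rule mult_mat_vec_carrier)
  define u where "u = v - P *\<^sub>v v"
  have u: "u \<in> carrier_vec d" using v Pc by (simp add: u_def)
  have Pu: "P *\<^sub>v u = 0\<^sub>v d"
    unfolding u_def mult_minus_distrib_mat_vec[OF P v Pc[OF v]] idem[OF v] using Pc[OF v] by simp
  have v_eq: "v = P *\<^sub>v v + u"
    using v P by (intro eq_vecI) (auto simp: u_def simp del: index_mult_mat_vec(1))
  have u_P: "cinner u (P *\<^sub>v x) = 0" if "x \<in> carrier_vec d" for x
    using symm[OF u that] Pu that by (simp add: cinner_def)
  \<comment> \<open>Lets a vector orthogonal to \<open>S\<close> and to \<open>v\<close> be
    recognised as orthogonal to \<open>u\<close>, so that \<open>Q\<close> kills it.\<close>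
  have u_eq: "cinner u x = cinner v x" if "x \<in> carrier_vec d" "P *\<^sub>v x = 0\<^sub>v d" for x
  proof -
    have "cinner x (P *\<^sub>v v) = 0"
      using symm[OF that(1) v] that(2) v by (simp add: cinner_def)
    then have "cinner x u = cinner x v"
      unfolding u_def cinner_diff_right[OF that(1) v Pc[OF v]] by simp
    then show ?thesis using cinner_commute that(1) u v by metis
  qed
  show ?case
  proof (cases "cinner u u = 0")
    case True
    then have "P *\<^sub>v v = v"
      using v_eq cinner_self_eq_0[OF u] Pc[OF v] by simp
    then show ?thesis
      using P idem symm fix_S perp by (intro exI[of _ P]) (simp add: orth_projection_def)
  next
    case False
    define c where "c = 1 / cinner u u"
    have c: "cnj c = c" by (simp add: c_def cinner_self)
    define Q where "Q = P + mat d d (\<lambda>(i, j). c * u $ i * cnj (u $ j))"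
    have Q: "Q \<in> carrier_mat d d" using P by (simp add: Q_def)
    have Qx: "Q *\<^sub>v x = P *\<^sub>v x + (c * cinner u x) \<cdot>\<^sub>v u" if x: "x \<in> carrier_vec d" for x
    proof -
      have "mat d d (\<lambda>(i, j). c * u $ i * cnj (u $ j)) *\<^sub>v x = (c * cinner u x) \<cdot>\<^sub>v u"
        using u x by (intro eq_vecI)
          (auto simp: scalar_prod_def cinner_def sum_distrib_left sum_distrib_right atLeast0LessThan mult_ac)
      then show ?thesis
        unfolding Q_def using add_mult_distrib_mat_vec[OF P _ x] by simp
    qed
    have zero: "0 \<cdot>\<^sub>v u = 0\<^sub>v d"
      using u by (intro eq_vecI) auto
    have Qfix: "Q *\<^sub>v x = x" if "x \<in> carrier_vec d" "P *\<^sub>v x = x" for x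
      using Qx[OF that(1)] u_P[OF that(1)] that zero by simp
    have Qu: "Q *\<^sub>v (k \<cdot>\<^sub>v u) = k \<cdot>\<^sub>v u" for k
    proof -
      have "P *\<^sub>v (k \<cdot>\<^sub>v u) = 0\<^sub>v d"
        unfolding mult_mat_vec[OF P u] Pu by (intro eq_vecI) auto
      moreover have "c * cinner u (k \<cdot>\<^sub>v u) = k"
        using False unfolding cinner_smult_right[OF u u] by (simp add: c_def)
      ultimately show ?thesis
        using Qx[of "k \<cdot>\<^sub>v u"] u by simp
    qed
    have "Q *\<^sub>v (Q *\<^sub>v x) = Q *\<^sub>v x" if x: "x \<in> carrier_vec d" for x
      unfolding Qx[OF x] using mult_add_distrib_mat_vec[OF Q Pc[OF x]] u
      by (simp add: Qfix Pc x idem Qu)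
    moreover have "cinner (Q *\<^sub>v x) y = cinner x (Q *\<^sub>v y)"
      if x: "x \<in> carrier_vec d" and y: "y \<in> carrier_vec d" for x y
    proof -
      have form: "cinner z (Q *\<^sub>v y) = cinner z (P *\<^sub>v y) + c * cinner u y * cinner z u"
        if "z \<in> carrier_vec d" "y \<in> carrier_vec d" for y z
        using that u cinner_add_right[OF that(1) Pc[OF that(2)], of "(c * cinner u y) \<cdot>\<^sub>v u"]
          cinner_smult_right[OF that(1) u] by (simp add: Qx)
      have "cinner (Q *\<^sub>v x) y = cnj (cinner y (Q *\<^sub>v x))"
        using Q x y by (intro cinner_commute) auto
      also have "\<dots> = cinner (P *\<^sub>v x) y + c * cinner u y * cinner x u"
        unfolding form[OF y x] using cinner_commute[OF Pc[OF x] y] cinner_commute[OF x u] cinner_commute[OF u y]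
        by (simp add: c)
      also have "\<dots> = cinner x (Q *\<^sub>v y)"
        unfolding form[OF x y] symm[OF x y] ..
      finally show ?thesis .
    qed
    ultimately have "orth_projection d Q"
      using Q by (simp add: orth_projection_def)
    moreover have "Q *\<^sub>v s = s" if "s \<in> insert v S" for s
    proof (cases "s = v")
      case True
      have "Q *\<^sub>v v = Q *\<^sub>v (P *\<^sub>v v + 1 \<cdot>\<^sub>v u)"
        using v_eq by simp
      also have "\<dots> = P *\<^sub>v v + 1 \<cdot>\<^sub>v u"
        using mult_add_distrib_mat_vec[OF Q Pc[OF v], of "1 \<cdot>\<^sub>v u"] u Qfix[OF Pc[OF v] idem[OF v]] Qu[of 1] by simp
      finally show ?thesis using True v_eq by simp
    next
      case False
      then show ?thesis using that S fix_S by (intro Qfix) auto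
    qed
    moreover have "Q *\<^sub>v x = 0\<^sub>v d" if "x \<in> carrier_vec d" "\<forall>s\<in>insert v S. cinner s x = 0" for x
      using Qx[OF that(1)] perp[OF that(1)] u_eq[OF that(1)] that zero by simp
    ultimately show ?thesis by blast
  qed
qed

section \<open>Querying every tensor factor in turn\<close>

text \<open>
  For \<open>N = n ^ M\<close> this is a cyclic shift of the \<open>M + 1\<close> base-\<open>n\<close> digits, bringing a fresh tensor factor
  into the query register, which is the most significant digit.
\<close>
definition rotate_index :: "nat \<Rightarrow> nat \<Rightarrow> nat \<Rightarrow> nat" where
  "rotate_index n N r = (r mod n) * N + r div n"

lemma unitary_rotate_index:
  assumes "0 < n" "0 < N"
  shows "unitary_mat (n * N) (row_map_mat (n * N) (rotate_index n N))"
proof (rule unitary_row_map_mat, rule bij_betw_byWitness)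
  let ?g = "\<lambda>r. (r mod N) * n + r div N"
  have div: "r div n < N" "r div N < n" if "r < n * N" for r
    using that assms by (auto simp: div_less_iff_less_mult mult.commute)
  show "\<forall>r\<in>{..<n * N}. ?g (rotate_index n N r) = r"
  proof
    fix r assume "r \<in> {..<n * N}"
    then have "r div n < N" using div by simp
    then show "?g (rotate_index n N r) = r" by (simp add: rotate_index_def)
  qed
  show "\<forall>r\<in>{..<n * N}. rotate_index n N (?g r) = r"
  proof
    fix r assume "r \<in> {..<n * N}"
    then have "r div N < n" using div by simp
    then show "rotate_index n N (?g r) = r" by (simp add: rotate_index_def)
  qed
  show "rotate_index n N ` {..<n * N} \<subseteq> {..<n * N}"
    using assms div by (auto simp: rotate_index_def intro!: mult_add_less)
  show "?g ` {..<n * N} \<subseteq> {..<n * N}"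
    using assms div mult_add_less[of _ N _ n] by (auto simp: mult.commute[of n N])
qed

text \<open>
  With \<open>b = inv a\<close>, a query to \<open>a\<close> followed by \<open>rotate_index\<close> substitutes \<open>query_index n N b\<close> for the
  index of a state vector.
\<close>
definition query_index :: "nat \<Rightarrow> nat \<Rightarrow> (nat \<Rightarrow> nat) \<Rightarrow> nat \<Rightarrow> nat" where
  "query_index n N b r = b (r mod n) * N + r div n"

lemma query_index_less:
  "0 < n \<Longrightarrow> (\<And>i. i < n \<Longrightarrow> b i < n) \<Longrightarrow> r < n * N \<Longrightarrow> query_index n N b r < n * N"
  unfolding query_index_def by (intro mult_add_less) (auto simp: div_less_iff_less_mult mult.commute)

text \<open>Each round of oracle and rotation pulls coordinates back along
  \<open>query_index\<close>, so rounds iterate this map.\<close>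

lemma final_state_rotations:
  assumes a: "a permutes {..<n}" and "0 < n" and psi: "psi \<in> carrier_vec (n * N)"
  shows "final_state n N psi (replicate j (row_map_mat (n * N) (rotate_index n N))) a =
    vec (n * N) (\<lambda>r. psi $ (query_index n N (Hilbert_Choice.inv a) ^^ j) r)"
proof (induction j)
  case 0
  then show ?case using psi by (auto simp: final_state_def)
next
  case (Suc j)
  let ?U = "row_map_mat (n * N) (rotate_index n N)" and ?b = "Hilbert_Choice.inv a"
  let ?k = "query_index n N ?b"
  let ?p = "\<lambda>r. ?b (r div N) * N + r mod N"
  let ?v = "vec (n * N) (\<lambda>r. psi $ (?k ^^ j) r)"
  have b: "i < n \<Longrightarrow> ?b i < n" for i
    using permutes_in_image[OF permutes_inv[OF a]] by auto
  have state: "final_state n N psi (replicate (Suc j) ?U) a = ?U *\<^sub>v (perm_tensor n N a *\<^sub>v ?v)"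
    using Suc unfolding replicate_Suc replicate_append_same[symmetric] by (simp add: final_state_def)
  have "(?U *\<^sub>v (perm_tensor n N a *\<^sub>v ?v)) $ r = psi $ (?k ^^ Suc j) r" if r: "r < n * N" for r
  proof -
    have N: "N > 0" using r by (cases N) auto
    have div: "r div n < N" using r \<open>0 < n\<close> by (simp add: div_less_iff_less_mult mult.commute)
    have rot: "rotate_index n N r < n * N"
      using div \<open>0 < n\<close> by (auto simp: rotate_index_def intro!: mult_add_less)
    have p: "?p (rotate_index n N r) = ?k r"
      using N div by (simp add: rotate_index_def query_index_def)
    have kr: "?k r < n * N" using query_index_less \<open>0 < n\<close> b r by blast
    have v: "?v \<in> carrier_vec (n * N)" by simp
    have "(?U *\<^sub>v (perm_tensor n N a *\<^sub>v ?v)) $ r = (perm_tensor n N a *\<^sub>v ?v) $ rotate_index n N r"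
      by (intro row_map_mat_mult_vec mult_mat_vec_carrier[OF perm_tensor_carrier v] r rot)
    also have "\<dots> = ?v $ ?k r"
      unfolding perm_tensor_eq_row_map_mat[OF a]
      using row_map_mat_mult_vec[OF v rot, of ?p] p kr by simp
    finally show ?thesis using kr by (simp add: funpow_swap1)
  qed
  then show ?case unfolding state
    by (intro eq_vecI) (auto simp: row_map_mat_def simp del: index_mult_mat_vec)
qed

lemma digit_query_index:
  assumes "0 < n" "\<And>i. i < n \<Longrightarrow> b i < n" "r < n ^ Suc M" "l \<le> M"
  shows "digit n l (query_index n (n ^ M) b r) =
    (if l < M then digit n (Suc l) r else b (digit n 0 r))"
proof -
  have "r div n < n ^ M"
    using assms(1,3) by (simp add: div_less_iff_less_mult mult.commute)
  then show ?thesis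
    using assms digit_add_top_low[of n l M "r div n" "b (r mod n)"] digit_add_top[of "r div n" n M "b (r mod n)"]
    by (auto simp: query_index_def add.commute digit_div) (simp add: digit_def)
qed

text \<open>Every round moves the digits down one place; a digit leaving position 0 passes through
  \<open>b\<close> and re-enters at position \<open>M\<close>. Within \<open>Suc M\<close> rounds
  this happens at most once per digit, whence the single case split.\<close>

lemma digit_query_index_funpow:
  assumes "0 < n" "\<And>i. i < n \<Longrightarrow> b i < n" "r < n ^ Suc M" "l \<le> M" "j \<le> Suc M"
  shows "digit n l ((query_index n (n ^ M) b ^^ j) r) =
    (if l + j \<le> M then digit n (l + j) r else b (digit n (l + j - Suc M) r))"
  using assms(4,5)
proof (induction j arbitrary: l)
  case (Suc j)
  let ?k = "query_index n (n ^ M) b"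
  have less: "(?k ^^ i) r < n ^ Suc M" for i
    by (induction i) (use assms(1-3) query_index_less[of n b _ "n ^ M"] in auto)
  show ?case
  proof (cases "l < M")
    case True
    then show ?thesis
      using Suc digit_query_index[OF assms(1,2) less] by simp
  next
    case False
    then show ?thesis
      using Suc digit_query_index[OF assms(1,2) less, where l = l] by auto
  qed
qed simp

text \<open>A full cycle returns every digit to its place with \<open>b\<close> applied exactly
  once, so \<open>b\<close> is substituted into every factor of the wedge product.\<close>

lemma slater_query_index_funpow:
  assumes "0 < n" "\<And>i. i < n \<Longrightarrow> b i < n" "r < n ^ Suc M"
  shows "slater n (Suc M) f ((query_index n (n ^ M) b ^^ Suc M) r) =
    slater n (Suc M) (\<lambda>k i. f k (b i)) r"
  unfolding slater_def
  by (intro arg_cong[where f = det] cong_mat refl)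
    (simp del: funpow.simps add: digit_query_index_funpow[OF assms])

section \<open>Exact algorithm with \<open>n div 2\<close> queries\<close>

lemma sign_inv_compose:
  assumes "a permutes {..<n :: nat}" "b permutes {..<n}" "sign a \<noteq> sign b"
  shows "sign (Hilbert_Choice.inv b \<circ> a) \<noteq> 1"
proof -
  have "permutation a" "permutation b"
    using assms by (auto simp: permutation_permutes)
  then have "sign (Hilbert_Choice.inv b \<circ> a) = sign b * sign a"
    by (simp add: sign_compose permutation_inverse sign_inverse)
  then show ?thesis
    using assms(3) by (cases rule: sign_cases[of a]; cases rule: sign_cases[of b]) auto
qed

lemma sign_distinguishing_states:
  assumes "n \<ge> 2"
  obtains N psi Us where "N \<ge> 1" "psi \<in> carrier_vec (n * N)" "cinner psi psi = 1"
    "length Us = n div 2" "\<forall>U \<in> set Us. unitary_mat (n * N) U"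
    "\<And>a b. a permutes {..<n} \<Longrightarrow> b permutes {..<n} \<Longrightarrow> sign a \<noteq> sign b \<Longrightarrow>
      cinner (final_state n N psi Us a) (final_state n N psi Us b) = 0"
proof -
  obtain M where M: "n div 2 = Suc M"
    using assms by (cases "n div 2") auto
  have n: "n > 0" using assms by simp
  define N where "N = n ^ M"
  have nN: "n * N = n ^ Suc M" by (simp add: N_def)
  \<comment> \<open>Slater determinants of orthonormal vectors have squared norm
    \<open>fact (Suc M)\<close>, which \<open>x\<close> compensates.\<close>
  define x :: real where "x = 1 / sqrt (fact (Suc M))"
  have x: "x * x * fact (Suc M) = 1"
    by (simp add: x_def del: fact_Suc)
  define c where "c = complex_of_real x"
  have c: "cnj c * c * fact (Suc M) = 1"
  proof -
    have "cnj c * c * fact (Suc M) = complex_of_real (x * x * fact (Suc M))"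
      by (simp add: c_def del: fact_Suc)
    then show ?thesis by (simp only: x of_real_1)
  qed
  define psi where "psi = vec (n * N) (\<lambda>r. c * slater n (Suc M) (fourier n) r)"
  define Us where "Us = replicate (n div 2) (row_map_mat (n * N) (rotate_index n N))"
  have psi: "psi \<in> carrier_vec (n * N)" by (simp add: psi_def)
  have inner: "cinner (vec (n * N) (\<lambda>r. c * slater n (Suc M) f r)) (vec (n * N) (\<lambda>r. c * slater n (Suc M) g r)) =
      det (mat (Suc M) (Suc M) (\<lambda>(k, l). \<Sum>i<n. cnj (f k i) * g l i))" for f g
  proof -
    have "cinner (vec (n * N) (\<lambda>r. c * slater n (Suc M) f r)) (vec (n * N) (\<lambda>r. c * slater n (Suc M) g r)) =
      cnj c * c * (\<Sum>r<n ^ Suc M. cnj (slater n (Suc M) f r) * slater n (Suc M) g r)"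
      unfolding cinner_def nN sum_distrib_left by (intro sum.cong) (auto simp: mult_ac)
    then show ?thesis
      unfolding slater_inner[OF n] using c by (simp flip: mult.assoc)
  qed
  have state: "final_state n N psi Us a =
      vec (n * N) (\<lambda>r. c * slater n (Suc M) (\<lambda>k i. fourier n k (Hilbert_Choice.inv a i)) r)"
    if a: "a permutes {..<n}" for a
  proof -
    let ?k = "query_index n N (Hilbert_Choice.inv a)"
    have b: "i < n \<Longrightarrow> Hilbert_Choice.inv a i < n" for i
      using permutes_in_image[OF permutes_inv[OF a]] by auto
    have less: "(?k ^^ j) r < n * N" if "r < n * N" for j r
      by (induction j) (use n b that query_index_less[of n "Hilbert_Choice.inv a" _ N] in auto)
    show ?thesis
      unfolding Us_def final_state_rotations[OF a n psi] M
    proof (intro eq_vecI; clarsimp simp del: funpow.simps)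
      fix r assume r: "r < n * N"
      show "psi $ (?k ^^ Suc M) r = c * slater n (Suc M) (\<lambda>k i. fourier n k (Hilbert_Choice.inv a i)) r"
        using less[OF r, of "Suc M"] slater_query_index_funpow[OF n b, where r = r and M = M and f = "fourier n"] r
        unfolding psi_def nN by (simp add: N_def del: funpow.simps)
    qed
  qed
  have "cinner psi psi = det (mat (Suc M) (Suc M) (\<lambda>(k, l). \<Sum>i<n. cnj (fourier n k i) * fourier n l i))"
    unfolding psi_def by (rule inner)
  also have "mat (Suc M) (Suc M) (\<lambda>(k, l). \<Sum>i<n. cnj (fourier n k i) * fourier n l i) = 1\<^sub>m (Suc M)"
    using M by (intro eq_matI) (auto simp: fourier_orthonormal)
  finally have norm: "cinner psi psi = 1" by simp
  have "cinner (final_state n N psi Us a) (final_state n N psi Us b) = 0"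
    if a: "a permutes {..<n}" and b: "b permutes {..<n}" and "sign a \<noteq> sign b" for a b
  proof -
    let ?\<tau> = "Hilbert_Choice.inv b \<circ> a"
    \<comment> \<open>Reindexing by \<open>a\<close> merges both inverses into one permutation,
      which is odd when the signs differ.\<close>
    have "(\<Sum>i<n. cnj (fourier n k (Hilbert_Choice.inv a i)) * fourier n l (Hilbert_Choice.inv b i)) =
        (\<Sum>i<n. cnj (fourier n k i) * fourier n l (?\<tau> i))" for k l
      by (subst sum.permute[OF a]) (simp add: permutes_inverses[OF a])
    then have "cinner (final_state n N psi Us a) (final_state n N psi Us b) =
        det (mat (n div 2) (n div 2) (\<lambda>(k, l). \<Sum>i<n. cnj (fourier n k i) * fourier n l (?\<tau> i)))"
      by (simp add: state[OF a] state[OF b] inner M)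
    also have "\<dots> = 0"
      using M sign_inv_compose[OF that]
      by (intro isotropic_gram_det_eq_0[where \<tau> = ?\<tau>] fourier_orthonormal fourier_cnj fourier_last
          permutes_compose[OF a] permutes_inv[OF b]) auto
    finally show ?thesis .
  qed
  moreover have "\<forall>U\<in>set Us. unitary_mat (n * N) U"
    using unitary_rotate_index[OF n, of N] n by (auto simp: Us_def N_def)
  ultimately show ?thesis
    using that[of N psi Us] n psi norm by (simp add: N_def Us_def)
qed

theorem theorem21:
  fixes n :: nat
  assumes "n \<ge> 2"
  shows "(\<exists>N psi Us Ep Em. query_alg n (n div 2) N psi Us Ep Em \<and>
            success_prob n N psi Us Ep Em = 1)
       \<and> (\<forall>t < n div 2. opt_success n t = 1 / 2)"
proof (intro conjI allI impI)
  fix t assume "t < n div 2"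
  then show "opt_success n t = 1 / 2" by (intro opt_success_eq_half) auto
next
  obtain N psi Us where alg: "N \<ge> 1" "psi \<in> carrier_vec (n * N)" "cinner psi psi = 1"
    "length Us = n div 2" "\<forall>U \<in> set Us. unitary_mat (n * N) U"
    and orth: "\<And>a b. a permutes {..<n} \<Longrightarrow> b permutes {..<n} \<Longrightarrow> sign a \<noteq> sign b \<Longrightarrow>
      cinner (final_state n N psi Us a) (final_state n N psi Us b) = 0"
    using sign_distinguishing_states[OF assms] by metis
  let ?v = "final_state n N psi Us" and ?d = "n * N"
  let ?even = "{a. a permutes {..<n} \<and> sign a = 1}"
  have v: "?v a \<in> carrier_vec ?d" for a
    by (rule final_state_carrier[OF alg(2,5)])
  have "finite (?v ` ?even)"
    by (rule finite_imageI, rule finite_subset[of _ "{a. a permutes {..<n}}"])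
      (auto simp: finite_permutations)
  \<comment> \<open>\<open>P\<close> projects onto the span of the final states of even
    permutations; those of odd ones are orthogonal to it, so measuring \<open>P\<close> never
    errs.\<close>
  then obtain P where P: "orth_projection ?d P" "\<And>a. a \<in> ?even \<Longrightarrow> P *\<^sub>v ?v a = ?v a"
    "\<And>x. x \<in> carrier_vec ?d \<Longrightarrow> (\<And>a. a \<in> ?even \<Longrightarrow> cinner (?v a) x = 0) \<Longrightarrow> P *\<^sub>v x = 0\<^sub>v ?d"
    using exists_orth_projection[of "?v ` ?even" ?d] v by (auto simp: image_subset_iff)
  have povm: "povm2 ?d P (1\<^sub>m ?d - P)"
    by (rule orth_projection_povm2[OF P(1)])
  have "cinner (?v a) ((if sign a = 1 then P else 1\<^sub>m ?d - P) *\<^sub>v ?v a) = 1"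
    if a: "a permutes {..<n}" for a
  proof -
    have norm: "cinner (?v a) (?v a) = 1"
      using final_state_norm[OF alg(2,5) a] alg(3) by simp
    show ?thesis
    proof (cases "sign a = 1")
      case True
      then show ?thesis using P(2)[of a] a norm by simp
    next
      case False
      then have "P *\<^sub>v ?v a = 0\<^sub>v ?d"
        using orth a by (intro P(3) v) auto
      then have "cinner (?v a) (P *\<^sub>v ?v a) = 0"
        using v[of a] by (simp add: cinner_def)
      then have "cinner (?v a) ((1\<^sub>m ?d - P) *\<^sub>v ?v a) = 1"
        using norm povm2_form_sum[OF povm v[of a]] by simp
      then show ?thesis using False by simp
    qed
  qed
  then have "success_prob n N psi Us P (1\<^sub>m ?d - P) = 1"
    by (simp add: success_prob_def card_permutes_lessThan)
  moreover have "query_alg n (n div 2) N psi Us P (1\<^sub>m ?d - P)"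
    using alg povm by (simp add: query_alg_def)
  ultimately show "\<exists>N psi Us Ep Em. query_alg n (n div 2) N psi Us Ep Em \<and>
      success_prob n N psi Us Ep Em = 1" by blast
qed

end
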